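(* Let $G$ be a finite abelian group of exponent $n$, where $n$ is odd and $n \ge 3$, and let $H = \mathcal{B}_{\pm}(G)$. Let $D_1 = \{ d-2 \colon d \in \mathbb{N},\ d \mid n,\ d \ge 3\}$ and let $D_2 = \{ d' \in \mathbb{N} \colon d' \mid d \text{ for some } d \in D_1\}$. Then $D_1 \subseteq \Delta^{\ast}(H) \subseteq D_2$. In particular, $\max \Delta^{\ast}(H) = n-2$.
   Context: All groups are abelian, written additively. For a subset $G_0$ of an abelian group $G$, a sequence over $G_0$ is an element of the free commutative monoid $\mathcal{F}(G_0)$, i.e. a finite unordered list $S = g_1 \cdots g_\ell$ of elements of $G_0$ (repetitions allowed), with multiplication given by concatenation and identity the empty sequence; $|S| = \ell$ is its length. $S$ is a plus-minus weighted zero-sum sequence if there are $\epsilon_i \in \{+1,-1\}$ with $\sum_{i=1}^{\ell} \epsilon_i g_i = 0$. $\mathcal{B}_{\pm}(G_0)$ denotes the submonoid of $\mathcal{F}(G_0)$ of all plus-minus weighted zero-sum sequences. For a (commutative, cancellative) monoid $H$ whose only unit is the identity: $b \mid_H a$ means $a = bc$ for some $c \in H$; an atom is a non-identity element with no factorization into two non-identity elements; for $a \in H$, $\mathsf{L}_H(a)$ is the set of all $k$ such that $a$ is a product of $k$ atoms. For a finite set $L = \{a_0 < a_1 < \dots < a_k\} \subseteq \mathbb{Z}$, $\Delta(L) = \{a_i - a_{i-1} \colon i \in [1,k]\}$; $\Delta(H) = \bigcup_{a \in H} \Delta(\mathsf{L}_H(a))$. A submonoid $S \subseteq H$ is divisor-closed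 if $s \in S$, $a \in H$, $a \mid_H s$ imply $a \in S$. The set of minimal distances is $\Delta^{\ast}(H) = \{\min \Delta(S) \colon S \subseteq H \text{ divisor-closed submonoid with } \Delta(S) \neq \emptyset\}$. *)

theory Defs
  imports "HOL-Library.Multiset"
begin

text \<open>
  A monoid is given as a subset of a cancellative commutative monoid type, written additively, so
  that its identity is \<open>0\<close>. A product of \<open>k\<close> atoms is then the sum of a multiset of size \<open>k\<close>.
\<close>

definition submonoid_on :: "'m::cancel_comm_monoid_add set \<Rightarrow> bool" where
  "submonoid_on H \<longleftrightarrow> 0 \<in> H \<and> (\<forall>a\<in>H. \<forall>b\<in>H. a + b \<in> H)"

definition divides_in :: "'m::cancel_comm_monoid_add set \<Rightarrow> 'm \<Rightarrow> 'm \<Rightarrow> bool" where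
  "divides_in H b a \<longleftrightarrow> (\<exists>c\<in>H. a = b + c)"

definition atom_in :: "'m::cancel_comm_monoid_add set \<Rightarrow> 'm \<Rightarrow> bool" where
  "atom_in H a \<longleftrightarrow> a \<in> H \<and> a \<noteq> 0 \<and> \<not> (\<exists>b\<in>H. \<exists>c\<in>H. b \<noteq> 0 \<and> c \<noteq> 0 \<and> a = b + c)"

definition length_set :: "'m::cancel_comm_monoid_add set \<Rightarrow> 'm \<Rightarrow> nat set" where
  "length_set H a = {size A | A. (\<forall>u\<in>#A. atom_in H u) \<and> \<Sum>\<^sub># A = a}"

definition successive_distances :: "nat set \<Rightarrow> nat set" where
  "successive_distances L = {b - a | a b. a \<in> L \<and> b \<in> L \<and> a < b \<and> (\<forall>c\<in>L. \<not> (a < c \<and> c < b))}"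

definition delta_set :: "'m::cancel_comm_monoid_add set \<Rightarrow> nat set" where
  "delta_set H = (\<Union>a\<in>H. successive_distances (length_set H a))"

definition divisor_closed_submonoid ::
    "'m::cancel_comm_monoid_add set \<Rightarrow> 'm set \<Rightarrow> bool" where
  "divisor_closed_submonoid S H \<longleftrightarrow>
     S \<subseteq> H \<and> submonoid_on S \<and> (\<forall>s\<in>S. \<forall>a\<in>H. divides_in H a s \<longrightarrow> a \<in> S)"

text \<open>Distance sets may be infinite a priori, hence \<open>LEAST\<close> instead of \<open>Min\<close>.\<close>

definition minimal_distances :: "'m::cancel_comm_monoid_add set \<Rightarrow> nat set" where
  "minimal_distances H =
     {(LEAST d. d \<in> delta_set S) | S. divisor_closed_submonoid S H \<and> delta_set S \<noteq> {}}"

text \<open>Sequences over a group are multisets; the signs refer to any enumeration of the terms, so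
  that equal terms may receive different signs.\<close>

definition plus_minus_zero_sum :: "'g::ab_group_add multiset \<Rightarrow> bool" where
  "plus_minus_zero_sum S \<longleftrightarrow>
     (\<exists>gs (\<epsilon> :: nat \<Rightarrow> int). mset gs = S \<and> (\<forall>i<length gs. \<epsilon> i \<in> {1, - 1}) \<and>
        (\<Sum>i<length gs. if \<epsilon> i = 1 then gs ! i else - (gs ! i)) = 0)"

definition plus_minus_monoid :: "'g::ab_group_add set \<Rightarrow> 'g multiset set" where
  "plus_minus_monoid G0 = {S. set_mset S \<subseteq> G0 \<and> plus_minus_zero_sum S}"

text \<open>The sum \<open>\<Sum>_<n. g\<close> is the \<open>n\<close>-fold multiple of \<open>g\<close>.\<close>

definition group_exponent :: "'g::ab_group_add set \<Rightarrow> nat" where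
  "group_exponent G = (LEAST n. 0 < n \<and> (\<forall>g\<in>G. (\<Sum>_<n. g) = 0))"

end

theory Submission
  imports Defs "HOL-Computational_Algebra.Primes"
begin

text \<open>
  Squares \<open>g\<^sup>2\<close> are weighted zero-sum, so every divisor-closed submonoid of \<open>H\<close> consists of all
  weighted zero-sum sequences over its support. If \<open>g\<close> has odd order \<open>d\<close>, then \<open>g\<^sup>2\<close> and \<open>g\<^sup>d\<close> are
  the atoms over \<open>{g}\<close>, and \<open>(g\<^sup>2)\<^sup>d = (g\<^sup>d)\<^sup>2\<close> has factorizations of lengths \<open>d\<close> and \<open>2\<close>. The minimal
  distance of a monoid divides every difference of two factorization lengths of an element; hence
  it divides \<open>d - 2\<close>, and over \<open>{g}\<close> alone all length differences are multiples of \<open>d - 2\<close>.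
\<close>

section \<open>Orders of elements\<close>

definition nat_multiple :: "nat \<Rightarrow> 'g::ab_group_add \<Rightarrow> 'g" where
  "nat_multiple k g = (\<Sum>_<k. g)"

text \<open>Asking for an equivalence instead of minimality makes \<open>d\<close> unique by
  antisymmetry of divisibility and turns computations with orders into divisibility arguments. The
  condition \<open>0 < d\<close> excludes infinite order.\<close>

definition has_order :: "'g::ab_group_add \<Rightarrow> nat \<Rightarrow> bool" where
  "has_order g d \<longleftrightarrow> 0 < d \<and> (\<forall>k. nat_multiple k g = 0 \<longleftrightarrow> d dvd k)"

lemma nat_multiple_0 [simp]: "nat_multiple 0 g = 0"
  and nat_multiple_Suc [simp]: "nat_multiple (Suc k) g = g + nat_multiple k g"
  by (simp_all add: nat_multiple_def add.commute)

lemma nat_multiple_add: "nat_multiple (j + k) g = nat_multiple j g + nat_multiple k g"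
  by (induction j) (simp_all add: add.assoc)

lemma nat_multiple_zero [simp]: "nat_multiple k 0 = 0"
  by (simp add: nat_multiple_def)

lemma nat_multiple_mult: "nat_multiple (j * k) g = nat_multiple j (nat_multiple k g)"
  by (induction j) (simp_all add: nat_multiple_add)

lemma nat_multiple_plus: "nat_multiple k (g + h) = nat_multiple k g + nat_multiple k h"
  by (simp add: nat_multiple_def sum.distrib)

text \<open>By pigeonhole two multiples of \<open>g\<close> coincide, so some positive multiple
  vanishes. Division with remainder by the least such \<open>d\<close> shows that \<open>d\<close>
  divides every other.\<close>

lemma has_order_exists:
  fixes g :: "'g::{ab_group_add, finite}"
  shows "\<exists>d. has_order g d"
proof -
  have "\<not> inj (\<lambda>k. nat_multiple k g)"
    using finite_imageD[of "\<lambda>k. nat_multiple k g" UNIV] by auto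
  then obtain i j where "i < j" "nat_multiple i g = nat_multiple j g"
    by (metis injI linorder_neqE_nat)
  then have ji: "nat_multiple (j - i) g = 0 \<and> 0 < j - i"
    using nat_multiple_add[of "j - i" i g] by simp
  define d where "d = (LEAST k. 0 < k \<and> nat_multiple k g = 0)"
  have d: "0 < d \<and> nat_multiple d g = 0"
    unfolding d_def
    by (rule LeastI[of _ "j - i"]) (use ji in blast)
  have least: "d \<le> k" if "0 < k" "nat_multiple k g = 0" for k
    unfolding d_def using that by (simp add: Least_le)
  have "d dvd k" if "nat_multiple k g = 0" for k
  proof -
    have "nat_multiple (k div d * d + k mod d) g = 0"
      using that by simp
    then have "nat_multiple (k mod d) g = 0"
      unfolding nat_multiple_add nat_multiple_mult using d by simp
    then have "k mod d = 0"
      using least[of "k mod d"] d by (meson gr0I leD mod_less_divisor)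
    then show ?thesis by auto
  qed
  moreover have "nat_multiple k g = 0" if "d dvd k" for k
    using that d by (auto simp: nat_multiple_mult mult.commute[of d])
  ultimately show ?thesis
    using d unfolding has_order_def by blast
qed

lemma has_order_multiple:
  assumes "has_order g (a * c)"
  shows "has_order (nat_multiple a g) c"
  using assms unfolding has_order_def
  by (auto simp: nat_multiple_mult[symmetric] mult.commute[of _ a])

text \<open>Multiplying a relation k(x + y) = 0 by \<open>a\<close> kills the \<open>x\<close> part
  and leaves \<open>b dvd a * k\<close>, so \<open>b dvd k\<close> by coprimality; symmetrically
  \<open>a dvd k\<close>.\<close>

lemma has_order_add_coprime:
  assumes "has_order x a" "has_order y b" "coprime a b"
  shows "has_order (x + y) (a * b)"
  unfolding has_order_def
proof (intro conjI allI iffI)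
  show "0 < a * b" using assms by (simp add: has_order_def)
  fix k
  show "nat_multiple k (x + y) = 0" if "a * b dvd k"
  proof -
    have "a dvd k" "b dvd k"
      using that by (auto intro: dvd_mult_left dvd_mult_right)
    then have "nat_multiple k x = 0" "nat_multiple k y = 0"
      using assms by (simp_all add: has_order_def)
    then show ?thesis
      by (simp add: nat_multiple_plus)
  qed
  assume 0: "nat_multiple k (x + y) = 0"
  have "nat_multiple (j * k) x + nat_multiple (j * k) y = 0" for j
    using 0 by (metis nat_multiple_mult nat_multiple_plus nat_multiple_zero)
  from this[of a] this[of b] have "b dvd a * k" "a dvd b * k"
    using assms(1,2) unfolding has_order_def
    by (metis add_0 dvd_triv_left, metis add_0_right dvd_triv_left)
  then show "a * b dvd k"
    using assms(3) by (meson coprime_commute coprime_dvd_mult_right_iff divides_mult)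
qed

text \<open>Take \<open>g\<close> of maximal order. If the order of some \<open>h\<close> did not
  divide it, exchanging the \<open>p\<close>-part of \<open>g\<close> for that of \<open>h\<close>
  at a suitable prime \<open>p\<close> would give a larger order. So the order of \<open>g\<close>
  annihilates the group, and no smaller positive number annihilates even \<open>g\<close>.\<close>

lemma
  fixes G :: "'g::{ab_group_add, finite} set"
  defines "G \<equiv> UNIV"
  shows exponent_is_order: "\<exists>g\<in>G. has_order g (group_exponent G)"
    and order_dvd_exponent: "\<And>g d. g \<in> G \<Longrightarrow> has_order g d \<Longrightarrow> d dvd group_exponent G"
proof -
  define ord :: "'g \<Rightarrow> nat" where "ord g = (SOME d. has_order g d)" for g
  have ord: "has_order g (ord g)" for g
    unfolding ord_def using has_order_exists by (rule someI_ex)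
  have unique: "ord g = d" if "has_order g d" for g d
    using that ord[of g] unfolding has_order_def by (meson dvd_antisym dvd_refl)
  have "Max (range ord) \<in> range ord"
    by (rule Max_in) auto
  then obtain g where g: "ord g = Max (range ord)" by (metis rangeE)
  have max: "ord h \<le> ord g" for h
    unfolding g by simp
  have pos: "0 < ord h" for h
    using ord has_order_def by blast
  have dvd: "ord h dvd ord g" for h
  proof (rule ccontr)
    assume "\<not> ord h dvd ord g"
    then obtain p where p: "prime p" "multiplicity p (ord g) < multiplicity p (ord h)"
      using pos by (metis linorder_not_le less_numeral_extra(3) multiplicity_le_imp_dvd)
    define i k where "i = multiplicity p (ord g)" and "k = multiplicity p (ord h)"
    obtain a where a: "ord g = p ^ i * a" "\<not> p dvd a"
      using multiplicity_decompose'[of "ord g" p] p pos[of g] unfolding i_def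
      by (metis not_prime_unit less_numeral_extra(3))
    obtain b where b: "ord h = b * p ^ k"
      using multiplicity_dvd[of p "ord h"] unfolding k_def by (metis dvdE mult.commute)
    \<comment> \<open>The factor \<open>p ^ i\<close> removes the \<open>p\<close>-part from the
      order of \<open>g\<close>; the factor \<open>b\<close> leaves only the \<open>p\<close>-part
      of the order of \<open>h\<close>. The sum then has order \<open>a * p ^ k\<close>, which is
      too large because \<open>i < k\<close>.\<close>
    have "has_order (nat_multiple (p ^ i) g) a" "has_order (nat_multiple b h) (p ^ k)"
      using ord[of g] ord[of h] a b by (auto intro: has_order_multiple)
    moreover have "coprime a (p ^ k)"
      using a(2) p(1) by (metis coprime_commute coprime_power_right_iff prime_imp_coprime)
    ultimately have "ord (nat_multiple (p ^ i) g + nat_multiple b h) = a * p ^ k"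
      by (intro unique has_order_add_coprime)
    then have "a * p ^ k \<le> p ^ i * a"
      using max a(1) by metis
    moreover have "0 < a" using a(1) pos[of g] by simp
    moreover have "p ^ i < p ^ k"
      using p prime_gt_1_nat by (simp add: i_def k_def)
    ultimately show False by (simp add: mult.commute)
  qed
  have exponent: "group_exponent G = ord g"
    unfolding G_def group_exponent_def
  proof (rule Least_equality)
    show "0 < ord g \<and> (\<forall>h\<in>UNIV :: 'g set. (\<Sum>_<ord g. h) = 0)"
      using pos dvd ord unfolding has_order_def nat_multiple_def by blast
    show "ord g \<le> m" if "0 < m \<and> (\<forall>h\<in>UNIV :: 'g set. (\<Sum>_<m. h) = 0)" for m
      using that ord[of g] unfolding has_order_def nat_multiple_def
      by (meson UNIV_I dvd_imp_le)
  qed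
  show "\<exists>g\<in>G. has_order g (group_exponent G)"
    using ord exponent G_def by auto
  show "d dvd group_exponent G" if "has_order h d" for h :: 'g and d
    using dvd[of h] unique[OF that] exponent by simp
qed

section \<open>Lengths and minimal distances\<close>

lemma submonoid_on_sum_mset:
  assumes "submonoid_on S" "\<forall>a\<in>#A. a \<in> S"
  shows "\<Sum>\<^sub># A \<in> S"
  using assms(2) by (induction A) (use assms(1) in \<open>auto simp: submonoid_on_def\<close>)

lemma length_set_add:
  assumes "x \<in> length_set S a" "y \<in> length_set S b"
  shows "x + y \<in> length_set S (a + b)"
proof -
  obtain A B where "x = size A" "\<forall>u\<in>#A. atom_in S u" "\<Sum>\<^sub># A = a"
    "y = size B" "\<forall>u\<in>#B. atom_in S u" "\<Sum>\<^sub># B = b"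
    using assms unfolding length_set_def by auto
  then show ?thesis
    unfolding length_set_def by (intro CollectI exI[of _ "A + B"]) auto
qed

lemma length_set_multiple:
  assumes "x \<in> length_set S a"
  shows "k * x \<in> length_set S (\<Sum>\<^sub># (replicate_mset k a))"
proof (induction k)
  case 0
  show ?case unfolding length_set_def by (intro CollectI exI[of _ "{#}"]) auto
next
  case (Suc k)
  then show ?case using length_set_add[OF assms] by simp
qed

lemma length_set_imp_mem:
  assumes "submonoid_on S" "x \<in> length_set S a"
  shows "a \<in> S"
  using assms submonoid_on_sum_mset[of S] unfolding length_set_def atom_in_def by auto

text \<open>The lengths \<open>x\<close> and \<open>y\<close> need not be adjacent, but the next
  length after \<open>x\<close> is at most \<open>y\<close>, and its gap to \<open>x\<close> is a
  successive distance.\<close>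

lemma delta_set_bound:
  assumes "submonoid_on S" "x \<in> length_set S a" "y \<in> length_set S a" "x < y"
  shows "\<exists>e\<in>delta_set S. e \<le> y - x"
proof -
  define z where "z = (LEAST z. z \<in> length_set S a \<and> x < z)"
  have z: "z \<in> length_set S a \<and> x < z"
    unfolding z_def by (rule LeastI[of _ y]) (use assms in simp)
  have least: "z \<le> c" if "c \<in> length_set S a" "x < c" for c
    unfolding z_def using that by (simp add: Least_le)
  have "\<forall>c\<in>length_set S a. \<not> (x < c \<and> c < z)"
    using least by (meson not_less)
  then have "z - x \<in> successive_distances (length_set S a)"
    unfolding successive_distances_def using z assms(2) by blast
  then have "z - x \<in> delta_set S"
    unfolding delta_set_def using length_set_imp_mem assms by blast
  then show ?thesis using least[OF assms(3,4)] by (intro bexI[of _ "z - x"]) auto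
qed

text \<open>Taking powers of two elements realizes the gcd of two length differences as a length difference.\<close>

lemma Least_delta_set_dvd:
  assumes "submonoid_on S" "x \<in> length_set S a" "y \<in> length_set S a" "x < y"
  shows "(LEAST d. d \<in> delta_set S) dvd y - x"
proof -
  define m where "m = (LEAST d. d \<in> delta_set S)"
  have m: "m \<in> delta_set S"
    unfolding m_def using delta_set_bound[OF assms] by (metis LeastI)
  have least: "m \<le> e" if "e \<in> delta_set S" for e
    unfolding m_def using that by (rule Least_le)
  obtain b u v where b: "u \<in> length_set S b" "v \<in> length_set S b" "u < v" "m = v - u"
    using m unfolding delta_set_def successive_distances_def by auto
  \<comment> \<open>Bezout over the naturals gives nonnegative coefficients, which can serve as
    exponents; it needs \<open>m\<close> to be nonzero, which follows from
    \<open>u < v\<close>.\<close>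
  obtain r s where rs: "m * r = (y - x) * s + gcd m (y - x)"
    using bezout_nat[of m "y - x"] b by auto
  define c where "c = \<Sum>\<^sub># (replicate_mset r b) + \<Sum>\<^sub># (replicate_mset s a)"
  \<comment> \<open>Short factorizations of \<open>b\<close> are paired with long ones of
    \<open>a\<close>, and vice versa, so that the lengths differ by r m - s (y - x), which is the
    gcd.\<close>
  have "r * u + s * y \<in> length_set S c" "r * v + s * x \<in> length_set S c"
    unfolding c_def using length_set_add length_set_multiple assms b by blast+
  moreover have diff: "r * v + s * x = r * u + s * y + gcd m (y - x)"
  proof -
    define e where "e = y - x"
    have "v = u + m" "y = x + e" using b assms by (auto simp: e_def)
    then show ?thesis using rs unfolding e_def[symmetric] by (simp add: algebra_simps)
  qed
  moreover have "0 < gcd m (y - x)" using assms by simp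
  ultimately obtain e where "e \<in> delta_set S" "e \<le> gcd m (y - x)"
    using delta_set_bound[OF assms(1), of "r * u + s * y" c "r * v + s * x"] by auto
  then have "m \<le> gcd m (y - x)" using least by fastforce
  moreover have "gcd m (y - x) \<le> m" using b by (simp add: gcd_le1_nat)
  ultimately show ?thesis unfolding m_def[symmetric] by (metis gcd_dvd2 le_antisym)
qed

section \<open>Plus-minus weighted zero-sum sequences\<close>

text \<open>\<open>A\<close> collects the terms with sign 1 and \<open>B\<close> all others.
  Induction from the end of the list keeps the indices of the earlier terms, and hence their signs,
  unchanged.\<close>

lemma signed_sum_split:
  fixes gs :: "'g::ab_group_add list" and \<epsilon> :: "nat \<Rightarrow> int"
  shows "\<exists>A B. mset gs = A + B \<and>
    (\<Sum>i<length gs. if \<epsilon> i = 1 then gs ! i else - (gs ! i)) = \<Sum>\<^sub># A - \<Sum>\<^sub># B"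
proof (induction gs rule: rev_induct)
  case Nil
  show ?case by simp
next
  case (snoc g gs)
  then obtain A B where AB: "mset gs = A + B"
    "(\<Sum>i<length gs. if \<epsilon> i = 1 then gs ! i else - (gs ! i)) = \<Sum>\<^sub># A - \<Sum>\<^sub># B" by blast
  have "(\<Sum>i<length gs. if \<epsilon> i = 1 then (gs @ [g]) ! i else - ((gs @ [g]) ! i)) = \<Sum>\<^sub># A - \<Sum>\<^sub># B"
    unfolding AB(2)[symmetric] by (rule sum.cong) (auto simp: nth_append)
  then have sum: "(\<Sum>i<length (gs @ [g]). if \<epsilon> i = 1 then (gs @ [g]) ! i else - ((gs @ [g]) ! i)) =
      \<Sum>\<^sub># A - \<Sum>\<^sub># B + (if \<epsilon> (length gs) = 1 then g else - g)"
    by simp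
  show ?case
  proof (cases "\<epsilon> (length gs) = 1")
    case True
    then show ?thesis
      unfolding sum using AB(1) by (intro exI[of _ "add_mset g A"] exI[of _ B]) simp
  next
    case False
    then show ?thesis
      unfolding sum using AB(1) by (intro exI[of _ A] exI[of _ "add_mset g B"]) simp
  qed
qed

text \<open>This form without signs and indices is the one used from here on. For the converse, the
  terms of \<open>A\<close> are listed first and those of \<open>B\<close> after them, so the sign
  depends only on whether the index is below \<open>length as\<close>.\<close>

lemma plus_minus_zero_sum_iff:
  "plus_minus_zero_sum S \<longleftrightarrow> (\<exists>A B. S = A + B \<and> \<Sum>\<^sub># A = \<Sum>\<^sub># B)"
proof
  assume "plus_minus_zero_sum S"
  then show "\<exists>A B. S = A + B \<and> \<Sum>\<^sub># A = \<Sum>\<^sub># B"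
    unfolding plus_minus_zero_sum_def using signed_sum_split by (metis right_minus_eq)
next
  assume "\<exists>A B. S = A + B \<and> \<Sum>\<^sub># A = \<Sum>\<^sub># B"
  then obtain as bs where S: "S = mset as + mset bs" "\<Sum>\<^sub># (mset as) = \<Sum>\<^sub># (mset bs)"
    by (metis ex_mset)
  define \<epsilon> :: "nat \<Rightarrow> int" where "\<epsilon> i = (if i < length as then 1 else - 1)" for i
  have "(\<Sum>i<length as + k. if \<epsilon> i = 1 then (as @ bs) ! i else - ((as @ bs) ! i)) =
      (\<Sum>i<length as. as ! i) - (\<Sum>i<k. bs ! i)" for k
    by (induction k) (auto simp: \<epsilon>_def nth_append intro!: sum.cong)
  also have "(\<Sum>i<length as. as ! i) - (\<Sum>i<length bs. bs ! i) = 0"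
    using S(2) by (simp add: sum_mset_sum_list sum_list_sum_nth atLeast0LessThan)
  finally have "(\<Sum>i<length (as @ bs). if \<epsilon> i = 1 then (as @ bs) ! i else - ((as @ bs) ! i)) = 0"
    by simp
  then show "plus_minus_zero_sum S"
    unfolding plus_minus_zero_sum_def using S(1)
    by (intro exI[of _ "as @ bs"] exI[of _ \<epsilon>]) (simp add: \<epsilon>_def)
qed

lemma plus_minus_zero_sum_add:
  assumes "plus_minus_zero_sum S" "plus_minus_zero_sum T"
  shows "plus_minus_zero_sum (S + T)"
proof -
  obtain A B C D where "S = A + B" "\<Sum>\<^sub># A = \<Sum>\<^sub># B" "T = C + D" "\<Sum>\<^sub># C = \<Sum>\<^sub># D"
    using assms unfolding plus_minus_zero_sum_iff by blast
  then show ?thesis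
    unfolding plus_minus_zero_sum_iff by (intro exI[of _ "A + C"] exI[of _ "B + D"]) (simp add: ac_simps)
qed

lemma plus_minus_zero_sum_double: "plus_minus_zero_sum (S + S)"
  unfolding plus_minus_zero_sum_iff by blast

section \<open>Divisor-closed submonoids and supports\<close>

lemma submonoid_on_plus_minus: "submonoid_on (plus_minus_monoid G0)"
  unfolding submonoid_on_def plus_minus_monoid_def
  using plus_minus_zero_sum_add plus_minus_zero_sum_double[of "{#}"] by auto

lemma divisor_closed_plus_minus:
  "divisor_closed_submonoid (plus_minus_monoid G0) (plus_minus_monoid UNIV)"
  unfolding divisor_closed_submonoid_def divides_in_def
  using submonoid_on_plus_minus by (auto simp: plus_minus_monoid_def)

text \<open>If \<open>g\<close> occurs in \<open>s \<in> S\<close>, then \<open>g\<^sup>2\<close> divides \<open>s\<^sup>2\<close>; and each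
  \<open>T\<close> divides \<open>T\<^sup>2\<close>, a product of such squares.\<close>

lemma divisor_closed_eq_plus_minus:
  assumes "divisor_closed_submonoid S (plus_minus_monoid UNIV)"
  shows "S = plus_minus_monoid (\<Union>s\<in>S. set_mset s)" (is "S = plus_minus_monoid ?G")
proof
  let ?H = "plus_minus_monoid UNIV"
  have S: "S \<subseteq> ?H" "submonoid_on S"
    and closed: "\<And>a b. a \<in> ?H \<Longrightarrow> b \<in> ?H \<Longrightarrow> a + b \<in> S \<Longrightarrow> a \<in> S"
    using assms unfolding divisor_closed_submonoid_def divides_in_def by blast+
  have H: "T + T \<in> ?H" for T
    by (simp add: plus_minus_monoid_def plus_minus_zero_sum_double)
  show "S \<subseteq> plus_minus_monoid ?G"
    using S(1) by (auto simp: plus_minus_monoid_def)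
  show "plus_minus_monoid ?G \<subseteq> S"
  proof
    fix T assume T: "T \<in> plus_minus_monoid ?G"
    have square: "{#g#} + {#g#} \<in> S" if g: "g \<in> ?G" for g
    proof -
      obtain s where s: "s \<in> S" "g \<in># s" using g by blast
      then obtain r where r: "s = add_mset g r" by (metis multi_member_split)
      have "({#g#} + {#g#}) + (r + r) \<in> S"
        using s S(2) unfolding submonoid_on_def r by fastforce
      then show ?thesis using closed H by blast
    qed
    have "U + U \<in> S" if "set_mset U \<subseteq> ?G" for U
      using that
    proof (induction U)
      case empty
      then show ?case using S(2) by (simp add: submonoid_on_def)
    next
      case (add g U)
      then have "({#g#} + {#g#}) + (U + U) \<in> S"
        using S(2) square[of g] unfolding submonoid_on_def by auto
      then show ?case by (simp add: ac_simps)
    qed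
    then have "T + T \<in> S" using T by (simp add: plus_minus_monoid_def)
    moreover have "T \<in> ?H" using T by (simp add: plus_minus_monoid_def)
    ultimately show "T \<in> S" using closed by blast
  qed
qed

section \<open>Sequences over a single element of odd order\<close>

lemma sum_mset_replicate_group:
  "\<Sum>\<^sub># (replicate_mset k g) = nat_multiple k (g::'g::ab_group_add)"
  by (induction k) simp_all

lemma replicate_eq_addE:
  assumes "replicate_mset k g = A + B"
  obtains a b where "A = replicate_mset a g" "B = replicate_mset b g" "k = a + b"
proof -
  have "set_mset (A + B) \<subseteq> {g}" unfolding assms[symmetric] by (auto split: if_splits)
  then have "A = replicate_mset (size A) g" "B = replicate_mset (size B) g"
    by (auto intro!: set_mset_subset_singletonD)
  moreover have "k = size A + size B" by (metis assms size_replicate_mset size_union)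
  ultimately show thesis using that by blast
qed

text \<open>With \<open>a\<close> plus signs and \<open>b\<close> minus signs, either
  \<open>a = b\<close> and \<open>k\<close> is even, or the difference of \<open>a\<close> and
  \<open>b\<close> is a positive multiple of \<open>d\<close>. Conversely, for odd \<open>k\<close>
  with \<open>d \<le> k\<close> the number \<open>k - d\<close> is even, and \<open>d\<close>
  surplus plus signs do no harm.\<close>

lemma replicate_mem_iff:
  assumes "has_order g d" "odd d" "g \<in> G0"
  shows "replicate_mset k g \<in> plus_minus_monoid G0 \<longleftrightarrow> even k \<or> d \<le> k"
proof
  assume "replicate_mset k g \<in> plus_minus_monoid G0"
  then obtain A B where "replicate_mset k g = A + B" "\<Sum>\<^sub># A = \<Sum>\<^sub># B"
    unfolding plus_minus_monoid_def plus_minus_zero_sum_iff by blast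
  then obtain a b where ab: "k = a + b" "nat_multiple a g = nat_multiple b g"
    by (metis replicate_eq_addE sum_mset_replicate_group)
  have *: "d \<le> j - i" if "nat_multiple i g = nat_multiple j g" "i < j" for i j
  proof -
    have "nat_multiple (j - i) g = 0"
      using that nat_multiple_add[of "j - i" i g] by simp
    then show ?thesis using assms(1) that(2) by (simp add: has_order_def dvd_imp_le)
  qed
  show "even k \<or> d \<le> k"
    using *[of a b] *[of b a] ab by (cases a b rule: linorder_cases) auto
next
  assume k: "even k \<or> d \<le> k"
  obtain a b where "k = a + b" "nat_multiple a g = nat_multiple b g"
  proof (cases "even k")
    case True
    then show thesis using that[of "k div 2" "k div 2"] by auto
  next
    case False
    then obtain b where "k - d = 2 * b" using k assms(2) by (metis evenE odd_even_add le_add_diff_inverse)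
    then have "k = b + d + b" using k False by auto
    moreover have "nat_multiple (b + d) g = nat_multiple b g"
      using assms(1) by (simp add: nat_multiple_add has_order_def)
    ultimately show thesis using that by blast
  qed
  then have "replicate_mset k g = replicate_mset a g + replicate_mset b g"
      "\<Sum>\<^sub># (replicate_mset a g) = \<Sum>\<^sub># (replicate_mset b g)"
    by (simp_all add: sum_mset_replicate_group multiset_eq_iff)
  then show "replicate_mset k g \<in> plus_minus_monoid G0"
    using assms(3) unfolding plus_minus_monoid_def plus_minus_zero_sum_iff
    by (intro CollectI conjI exI[of _ "replicate_mset a g"] exI[of _ "replicate_mset b g"])
       (auto split: if_splits)
qed

text \<open>The square of \<open>g\<close> splits off from every other power in the monoid. Neither
  exponent 2 nor exponent \<open>d\<close> can be decomposed: nontrivial parts are at least 2, and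
  parts below \<open>d\<close> are even, whereas \<open>d\<close> is odd.\<close>

lemma atom_replicate_iff:
  assumes "has_order g d" "odd d" "3 \<le> d" "g \<in> G0"
  shows "atom_in (plus_minus_monoid G0) (replicate_mset k g) \<longleftrightarrow> k = 2 \<or> k = d"
proof
  note mem = replicate_mem_iff[OF assms(1,2,4)]
  assume atom: "atom_in (plus_minus_monoid G0) (replicate_mset k g)"
  have k: "k \<noteq> 0" "even k \<or> d \<le> k"
    using atom mem[of k] unfolding atom_in_def by auto
  have no_split: False if "k = i + j" "even i \<or> d \<le> i" "even j \<or> d \<le> j" "0 < i" "0 < j" for i j
  proof -
    have "replicate_mset k g = replicate_mset i g + replicate_mset j g"
      by (simp add: that(1) multiset_eq_iff)
    moreover have "replicate_mset i g \<noteq> 0" "replicate_mset j g \<noteq> 0"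
      using that by (simp_all add: replicate_mset_eq_empty_iff)
    ultimately show False using atom mem[of i] mem[of j] that unfolding atom_in_def by blast
  qed
  show "k = 2 \<or> k = d"
  proof (rule ccontr)
    assume "\<not> (k = 2 \<or> k = d)"
    moreover from this have "2 < k" using k assms(3) by (cases "k = 1") auto
    \<comment> \<open>If \<open>k\<close> is odd, then \<open>d \<le> k\<close> and both are odd, so
      \<open>k\<close> is either \<open>d\<close> or at least \<open>d + 2\<close>.\<close>
    moreover have "even (k - 2) \<or> d \<le> k - 2 \<or> k = d"
      using k(2) assms(2) \<open>2 < k\<close> by (cases "even k") (auto, presburger)
    moreover have "k = 2 + (k - 2)" using \<open>2 < k\<close> by simp
    ultimately show False using no_split[of 2 "k - 2"] by auto
  qed
next
  note mem = replicate_mem_iff[OF assms(1,2,4)]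
  assume k: "k = 2 \<or> k = d"
  have False if bc: "b \<in> plus_minus_monoid G0" "c \<in> plus_minus_monoid G0" "b \<noteq> 0" "c \<noteq> 0"
    "replicate_mset k g = b + c" for b c
  proof -
    obtain i j where ij: "b = replicate_mset i g" "c = replicate_mset j g" "k = i + j"
      using replicate_eq_addE[OF bc(5)] .
    then have "even i \<or> d \<le> i" "even j \<or> d \<le> j" "0 < i" "0 < j"
      using bc mem by (auto intro: gr0I)
    \<comment> \<open>Exponent 1 is odd and below \<open>d\<close>, so it does not occur.\<close>
    moreover from this have "2 \<le> i" "2 \<le> j" using assms(3) by (cases "i = 1"; cases "j = 1"; simp)+
    ultimately show False using k ij(3) assms(2) by auto
  qed
  then show "atom_in (plus_minus_monoid G0) (replicate_mset k g)"
    using k mem[of k] assms(3) unfolding atom_in_def by (auto simp: replicate_mset_eq_empty_iff)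
qed

lemma length_set_square_power:
  assumes "has_order g d" "odd d" "3 \<le> d" "g \<in> G0"
  shows "2 \<in> length_set (plus_minus_monoid G0) (replicate_mset (2 * d) g)"
    and "d \<in> length_set (plus_minus_monoid G0) (replicate_mset (2 * d) g)"
proof -
  note atom = atom_replicate_iff[OF assms]
  have rep: "\<Sum>\<^sub># (replicate_mset k (replicate_mset m g)) = replicate_mset (k * m) g" for k m
    by (induction k) (auto simp: multiset_eq_iff)
  have "k \<in> length_set (plus_minus_monoid G0) (replicate_mset (k * m) g)" if "m = 2 \<or> m = d" for k m
    unfolding length_set_def
    by (intro CollectI exI[of _ "replicate_mset k (replicate_mset m g)"])
       (use that atom rep in \<open>auto split: if_splits\<close>)
  from this[of d 2] this[of 2 d]
  show "2 \<in> length_set (plus_minus_monoid G0) (replicate_mset (2 * d) g)"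
    and "d \<in> length_set (plus_minus_monoid G0) (replicate_mset (2 * d) g)"
    by (simp_all add: mult.commute)
qed

lemma Least_delta_set_plus_minus_dvd:
  assumes "has_order g d" "odd d" "3 \<le> d" "g \<in> G0"
  shows "(LEAST e. e \<in> delta_set (plus_minus_monoid G0)) dvd d - 2"
  using Least_delta_set_dvd[OF submonoid_on_plus_minus length_set_square_power[OF assms]] assms(3)
  by simp

lemma delta_set_plus_minus_nonempty:
  assumes "has_order g d" "odd d" "3 \<le> d" "g \<in> G0"
  shows "delta_set (plus_minus_monoid G0) \<noteq> {}"
  using delta_set_bound[OF submonoid_on_plus_minus length_set_square_power[OF assms]] assms(3)
  by auto

text \<open>A product of \<open>x\<close> atoms, \<open>b\<close> of which have size
  \<open>d\<close>, has size \<open>2 * x + (d - 2) * b\<close>. Comparing two factorizations of one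
  element shows that \<open>d - 2\<close> divides twice the difference of their lengths, and
  \<open>d - 2\<close> is odd.\<close>

lemma dvd_delta_set_singleton:
  assumes "has_order g d" "odd d" "3 \<le> d" "e \<in> delta_set (plus_minus_monoid {g})"
  shows "d - 2 dvd e"
proof -
  let ?S = "plus_minus_monoid {g}"
  have size: "\<exists>b. size (\<Sum>\<^sub># A) = 2 * size A + (d - 2) * b" if "\<forall>u\<in>#A. atom_in ?S u" for A
    using that
  proof (induction A)
    case empty
    show ?case by simp
  next
    case (add u A)
    then obtain b where b: "size (\<Sum>\<^sub># A) = 2 * size A + (d - 2) * b" by auto
    have u: "atom_in ?S u" using add by simp
    then have "set_mset u \<subseteq> {g}" by (simp add: atom_in_def plus_minus_monoid_def)
    then obtain k where k: "u = replicate_mset k g" by (metis set_mset_subset_singletonD)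
    then consider "k = 2" | "k = d" using u atom_replicate_iff[OF assms(1-3), of "{g}" k] by auto
    then show ?case
    proof cases
      case 1
      then show ?thesis using b k by (intro exI[of _ b]) simp
    next
      case 2
      then show ?thesis using b k assms(3) by (intro exI[of _ "Suc b"]) simp
    qed
  qed
  obtain a x y where e: "e = y - x" "x < y" "x \<in> length_set ?S a" "y \<in> length_set ?S a"
    using assms(4) unfolding delta_set_def successive_distances_def by auto
  obtain b c where bc: "size a = 2 * x + (d - 2) * b" "size a = 2 * y + (d - 2) * c"
    using size e(3,4) unfolding length_set_def mem_Collect_eq by metis
  \<comment> \<open>The subtraction does not truncate: since \<open>x < y\<close>, the factorization
    of length \<open>x\<close> has more atoms of size \<open>d\<close>.\<close>
  then have "2 * e = (d - 2) * b - (d - 2) * c"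
    unfolding e(1) using e(2) by linarith
  then have "2 * e = (d - 2) * (b - c)"
    by (simp only: diff_mult_distrib2)
  then have "d - 2 dvd 2 * e" by simp
  moreover have "coprime (d - 2) 2" using assms(2,3) by simp
  ultimately show ?thesis by (simp add: coprime_dvd_mult_right_iff)
qed

text \<open>The only possible atom is the one-term sequence 0, so every factorization of
  \<open>a\<close> has length \<open>size a\<close> and no distances arise. This forces a nonzero
  element into the support of any submonoid with a distance.\<close>

lemma delta_set_plus_minus_zero:
  assumes "G0 \<subseteq> {0}"
  shows "delta_set (plus_minus_monoid G0) = {}"
proof -
  let ?S = "plus_minus_monoid G0"
  have atom: "size u = 1" if "atom_in ?S u" for u
  proof -
    have "set_mset u \<subseteq> {0}" "u \<noteq> {#}"
      using that assms by (auto simp: atom_in_def plus_minus_monoid_def)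
    then obtain k where k: "u = replicate_mset (Suc k) 0"
      by (metis set_mset_subset_singletonD replicate_mset_0 not0_implies_Suc)
    have "0 \<in> G0" using that k by (auto simp: atom_in_def plus_minus_monoid_def)
    have "replicate_mset j 0 \<in> ?S" for j
      using \<open>0 \<in> G0\<close> unfolding plus_minus_monoid_def plus_minus_zero_sum_iff
      by (intro CollectI conjI exI[of _ "replicate_mset j 0"] exI[of _ "{#}"])
         (auto simp: sum_mset_replicate_group split: if_splits)
    from this[of 1] this[of k] have "{#0#} \<in> ?S" "replicate_mset k 0 \<in> ?S" by simp_all
    moreover have "u = {#0#} + replicate_mset k 0" using k by simp
    ultimately have "replicate_mset k 0 = (0 :: 'a multiset)"
      using that unfolding atom_in_def by (metis add_mset_not_empty)
    then show ?thesis using k by simp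
  qed
  have "size (\<Sum>\<^sub># A) = size A" if "\<forall>u\<in>#A. atom_in ?S u" for A
    using that by (induction A) (auto simp: atom)
  then have len: "x = size a" if "x \<in> length_set ?S a" for x a
    using that unfolding length_set_def by auto
  then show ?thesis
    unfolding delta_set_def successive_distances_def by (auto dest!: len)
qed

section \<open>Minimal distances of the full monoid\<close>

theorem theorem4p9:
  fixes H :: "'g::{ab_group_add, finite} multiset set"
    and n :: nat and D1 D2 :: "nat set"
  assumes "group_exponent (UNIV :: 'g set) = n"
    and "odd n" and "n \<ge> 3"
    and "H = plus_minus_monoid (UNIV :: 'g set)"
    and "D1 = {d - 2 | d. d dvd n \<and> d \<ge> 3}"
    and "D2 = {d'. \<exists>d\<in>D1. d' dvd d}"
  shows "D1 \<subseteq> minimal_distances H \<and> minimal_distances H \<subseteq> D2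
    \<and> Max (minimal_distances H) = n - 2"
proof -
  have D1: "D1 \<subseteq> minimal_distances H"
  proof
    fix e assume "e \<in> D1"
    then obtain d where d: "e = d - 2" "d dvd n" "3 \<le> d" using assms by blast
    obtain h :: 'g where "has_order h n" using exponent_is_order assms(1) by blast
    \<comment> \<open>Every divisor \<open>d\<close> of the exponent is an order, because
      \<open>n = (n div d) * d\<close>.\<close>
    then have "has_order (nat_multiple (n div d) h) d"
      using d(2) by (intro has_order_multiple) simp
    then obtain g :: 'g where g: "has_order g d" by blast
    have "odd d" using d(2) assms(2) dvd_trans by blast
    let ?S = "plus_minus_monoid {g}"
    note ord = g \<open>odd d\<close> d(3)
    have ne: "delta_set ?S \<noteq> {}" using delta_set_plus_minus_nonempty[OF ord] by simp
    then have "(LEAST e. e \<in> delta_set ?S) \<in> delta_set ?S"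
      by (metis LeastI_ex all_not_in_conv)
    \<comment> \<open>The least distance is itself a distance, hence a multiple of
      \<open>d - 2\<close>; it also divides \<open>d - 2\<close>.\<close>
    then have "(LEAST e. e \<in> delta_set ?S) = e"
      unfolding d(1) using dvd_delta_set_singleton[OF ord] Least_delta_set_plus_minus_dvd[OF ord, of "{g}"]
      by (auto intro: dvd_antisym)
    then show "e \<in> minimal_distances H"
      unfolding minimal_distances_def assms(4) using ne divisor_closed_plus_minus by blast
  qed
  have D2: "minimal_distances H \<subseteq> D2"
  proof
    fix e assume "e \<in> minimal_distances H"
    then obtain S where S: "e = (LEAST e. e \<in> delta_set S)" "divisor_closed_submonoid S H"
      "delta_set S \<noteq> {}" unfolding minimal_distances_def by blast
    then obtain G0 where G0: "S = plus_minus_monoid G0"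
      using divisor_closed_eq_plus_minus assms(4) by blast
    then obtain g where g: "g \<in> G0" "g \<noteq> 0" using S(3) delta_set_plus_minus_zero by blast
    obtain d where d: "has_order g d" using has_order_exists by blast
    have dn: "d dvd n" using order_dvd_exponent[OF UNIV_I d] assms(1) by simp
    then have "odd d" using assms(2) dvd_trans by blast
    moreover have "d \<noteq> 1" using d g(2) by (auto simp: has_order_def dest: spec[of _ 1])
    \<comment> \<open>A nonzero \<open>g\<close> of odd order has order at least 3, so the distance
      \<open>d - 2\<close> is available for every nonzero element of the support.\<close>
    ultimately have "3 \<le> d" by presburger
    then have "e dvd d - 2"
      using Least_delta_set_plus_minus_dvd[OF d \<open>odd d\<close> _ g(1)] S(1) G0 by simp
    then show "e \<in> D2" using assms dn \<open>3 \<le> d\<close> by blast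
  qed
  have le: "e \<le> n - 2" if e: "e \<in> D2" for e
  proof -
    obtain d where d: "e dvd d - 2" "d dvd n" "3 \<le> d" using e assms by blast
    then have "e \<le> d - 2" "d \<le> n" using assms(3) by (auto intro!: dvd_imp_le)
    then show ?thesis by simp
  qed
  \<comment> \<open>This is the choice \<open>d = n\<close>.\<close>
  have "n - 2 \<in> D1" using assms(3) unfolding assms(5) by auto
  then have "n - 2 \<in> minimal_distances H" using D1 by blast
  \<comment> \<open>\<open>Max\<close> is meaningful only for finite sets; finiteness comes from the
    bound \<open>n - 2\<close> on \<open>D2\<close>.\<close>
  moreover have "finite (minimal_distances H)"
    using D2 le by (meson finite_nat_set_iff_bounded_le subsetD)
  ultimately have "Max (minimal_distances H) = n - 2"
    using D2 le by (intro Max_eqI) auto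
  then show ?thesis using D1 D2 by blast
qed

end
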